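(* Let $\mathscr{E}$ be a quasi-potential multi-leader multi-follower game with associated functions $\phi_1,\dots,\phi_N$, $h$, $\pi$. Suppose $\mathcal{F}^{\rm quasi}$ is nonempty and $\varphi_i$ is continuous for $i=1,\dots,N$. If the optimization problem $$\mathrm{P}^{\rm quasi}:\qquad \min_{(x,w)}\ \pi(x)+h(x,w)\quad\text{subject to}\quad (x,w)\in\mathcal{F}^{\rm quasi}$$ has a global minimizer (for example, if either the objective $\pi+h$ is coercive over $\mathcal{F}^{\rm quasi}$ or $\mathcal{F}^{\rm quasi}$ is compact), then $\mathscr{E}$ admits a global Nash equilibrium.
   Context: Multi-leader multi-follower game $\mathscr{E}$: $\mathcal{N}=\{1,\dots,N\}$ is the set of leaders. Leader $i$ has a convex compact strategy set $X_i\subseteq\mathbb{R}^{m_i}$; $X=\prod_{i=1}^N X_i$. For $x=(x_1,\dots,x_N)$, $x^{-i}$ denotes $(x_1,\dots,x_{i-1},x_{i+1},\dots,x_N)$ and $(\bar x_i,x^{-i})$ denotes $x$ with $i$-th component replaced by $\bar x_i$. $Y$ is the ambient Euclidean space of follower strategy profiles. For each $x\in X$, the set of follower equilibria is $\mathcal{S}(x)\subseteq Y$, the (possibly multivalued, possibly empty) solution set of the variational inequality $\mathrm{VI}(G(x,\cdot),K(x))$, i.e. $\mathcal{S}(x)=\{y\in K(x): G(x,y)^\top(z-y)\ge 0\ \ \forall z\in K(x)\}$, where $K$ is a continuous set-valued map with closed convex values in $Y$ and $G$ is a continuous map of all its variables. Leader $i$ has a continuous objective $\varphi_i$ on $X\times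 Y$, written $\varphi_i(x_i,y_i;x^{-i})$, and (optimistic formulation) solves $$\mathrm{L}_i(x^{-i}):\quad \min_{x_i,y_i}\ \varphi_i(x_i,y_i;x^{-i})\quad\text{s.t. } x_i\in X_i,\ y_i\in\mathcal{S}(x).$$ Its feasible region is $\Omega_i(x^{-i})=\{(x_i,y_i): x_i\in X_i,\ y_i\in\mathcal{S}(x_i,x^{-i})\}$. Let $\mathcal{F}=\{(x,y): x_i\in X_i,\ y_i\in\mathcal{S}(x)\ \forall i\in\mathcal{N}\}$, with $y=(y_1,\dots,y_N)$. Global Nash equilibrium of $\mathscr{E}$: a point $(x,y)\in\mathcal{F}$ such that for all $i\in\mathcal{N}$ and all $(u_i,v_i)\in\Omega_i(x^{-i})$, $\varphi_i(x_i,y_i;x^{-i})\le\varphi_i(u_i,v_i;x^{-i})$. Quasi-potential game: $\mathscr{E}$ is quasi-potential if (i) there exist real-valued functions $\phi_1(x),\dots,\phi_N(x)$ on $X$ and a real-valued function $h$ on $X\times Y$ (the same for all leaders) such that $\varphi_i(x_i,y_i;x^{-i})=\phi_i(x)+h(x,y_i)$ for each $i$; and (ii) there is a function $\pi$ on $X$ such that for all $i$, all $x\in X$ and all $x_i'\in X_i$, $\phi_i(x_i;x^{-i})-\phi_i(x_i';x^{-i})=\pi(x_i;x^{-i})-\pi(x_i';x^{-i})$. The function $\pi+h$ is called the quasi-potential function. $\mathcal{F}^{\rm quasi}=\{(x,w): x_i\in X_i\ \forall i\in\mathcal{N},\ w\in\mathcal{S}(x)\}$. Coercive over $\mathcal{F}^{\rm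 quasi}$ means that the function tends to $+\infty$ as $\|(x,w)\|\to\infty$ with $(x,w)\in\mathcal{F}^{\rm quasi}$. *)

theory Defs
  imports "HOL-Analysis.Analysis"
begin

text \<open>
  The leaders are the elements of a finite type \<open>'l\<close>. To allow leaders whose
  strategy spaces have different dimensions, the space \<open>R^(m i)\<close> of leader
  \<open>i\<close> is a linear subspace \<open>V i\<close> of a common Euclidean space \<open>'a\<close>, with
  \<open>m i = dim (V i)\<close>. The follower space is the Euclidean space \<open>'y\<close>.
  A function of \<open>(x_i, y_i; x^(-i))\<close> is written as a function of the full
  profile \<open>x\<close> and of \<open>y_i\<close>.
\<close>

definition profiles :: "('l::finite \<Rightarrow> 'a set) \<Rightarrow> ('a ^ 'l) set" where
  "profiles X = {x. \<forall>i. x $ i \<in> X i}"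

definition deviate :: "'a ^ 'l \<Rightarrow> 'l::finite \<Rightarrow> 'a \<Rightarrow> 'a ^ 'l" where
  "deviate x i u = (\<chi> j. if j = i then u else x $ j)"

definition VI_solutions :: "('y::real_inner \<Rightarrow> 'y) \<Rightarrow> 'y set \<Rightarrow> 'y set" where
  "VI_solutions F C = {y \<in> C. \<forall>z\<in>C. F y \<bullet> (z - y) \<ge> 0}"

definition follower_eq ::
  "('x \<Rightarrow> 'y::real_inner \<Rightarrow> 'y) \<Rightarrow> ('x \<Rightarrow> 'y set) \<Rightarrow> 'x \<Rightarrow> 'y set" where
  "follower_eq G K x = VI_solutions (G x) (K x)"

text \<open>
  Continuity of a set-valued map relative to \<open>A\<close>, in the sense of Painleve and
  Kuratowski (outer and inner semicontinuity). For closed-valued maps it is implied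
  by Berge continuity (upper and lower semicontinuity defined through open sets).
\<close>

definition outer_semicontinuous_on ::
  "'x::topological_space set \<Rightarrow> ('x \<Rightarrow> 'y::topological_space set) \<Rightarrow> bool" where
  "outer_semicontinuous_on A K \<longleftrightarrow>
    (\<forall>x\<in>A. \<forall>\<xi> \<zeta> y. (\<forall>n::nat. \<xi> n \<in> A \<and> \<zeta> n \<in> K (\<xi> n)) \<and>
        \<xi> \<longlonglongrightarrow> x \<and> \<zeta> \<longlonglongrightarrow> y \<longrightarrow> y \<in> K x)"

definition inner_semicontinuous_on ::
  "'x::topological_space set \<Rightarrow> ('x \<Rightarrow> 'y::topological_space set) \<Rightarrow> bool" where
  "inner_semicontinuous_on A K \<longleftrightarrow>
    (\<forall>x\<in>A. \<forall>y\<in>K x. \<forall>\<xi>. (\<forall>n::nat. \<xi> n \<in> A) \<and> \<xi> \<longlonglongrightarrow> x \<longrightarrow>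
        (\<exists>\<zeta>. \<zeta> \<longlonglongrightarrow> y \<and> (\<forall>\<^sub>F n in sequentially. \<zeta> n \<in> K (\<xi> n))))"

definition set_valued_continuous_on ::
  "'x::topological_space set \<Rightarrow> ('x \<Rightarrow> 'y::topological_space set) \<Rightarrow> bool" where
  "set_valued_continuous_on A K \<longleftrightarrow>
    outer_semicontinuous_on A K \<and> inner_semicontinuous_on A K"

definition mlmf_game ::
  "('l::finite \<Rightarrow> 'a::euclidean_space set) \<Rightarrow> ('l \<Rightarrow> 'a set) \<Rightarrow>
   ('a ^ 'l \<Rightarrow> 'y::euclidean_space \<Rightarrow> 'y) \<Rightarrow> ('a ^ 'l \<Rightarrow> 'y set) \<Rightarrow>
   ('l \<Rightarrow> 'a ^ 'l \<Rightarrow> 'y \<Rightarrow> real) \<Rightarrow> bool" where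
  "mlmf_game V X G K \<phi> \<longleftrightarrow>
    (\<forall>i. subspace (V i) \<and> X i \<subseteq> V i \<and> convex (X i) \<and> compact (X i)) \<and>
    set_valued_continuous_on (profiles X) K \<and>
    (\<forall>x\<in>profiles X. closed (K x) \<and> convex (K x)) \<and>
    continuous_on (profiles X \<times> UNIV) (\<lambda>(x, y). G x y) \<and>
    (\<forall>i. continuous_on (profiles X \<times> UNIV) (\<lambda>(x, y). \<phi> i x y))"

text \<open>Below, \<open>S\<close> stands for the follower equilibrium map.\<close>

definition leader_feasible ::
  "('l::finite \<Rightarrow> 'a set) \<Rightarrow> ('a ^ 'l \<Rightarrow> 'y set) \<Rightarrow> 'l \<Rightarrow> 'a ^ 'l \<Rightarrow> ('a \<times> 'y) set" where
  "leader_feasible X S i x = {(u, v). u \<in> X i \<and> v \<in> S (deviate x i u)}"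

definition feasible ::
  "('l::finite \<Rightarrow> 'a set) \<Rightarrow> ('a ^ 'l \<Rightarrow> 'y set) \<Rightarrow> (('a ^ 'l) \<times> ('y ^ 'l)) set" where
  "feasible X S = {(x, y). \<forall>i. x $ i \<in> X i \<and> y $ i \<in> S x}"

definition global_nash ::
  "('l::finite \<Rightarrow> 'a set) \<Rightarrow> ('a ^ 'l \<Rightarrow> 'y set) \<Rightarrow> ('l \<Rightarrow> 'a ^ 'l \<Rightarrow> 'y \<Rightarrow> real) \<Rightarrow>
   'a ^ 'l \<Rightarrow> 'y ^ 'l \<Rightarrow> bool" where
  "global_nash X S \<phi> x y \<longleftrightarrow> (x, y) \<in> feasible X S \<and>
    (\<forall>i. \<forall>(u, v)\<in>leader_feasible X S i x. \<phi> i x (y $ i) \<le> \<phi> i (deviate x i u) v)"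

definition quasi_potential ::
  "('l::finite \<Rightarrow> 'a set) \<Rightarrow> ('l \<Rightarrow> 'a ^ 'l \<Rightarrow> 'y \<Rightarrow> real) \<Rightarrow>
   ('l \<Rightarrow> 'a ^ 'l \<Rightarrow> real) \<Rightarrow> ('a ^ 'l \<Rightarrow> 'y \<Rightarrow> real) \<Rightarrow> ('a ^ 'l \<Rightarrow> real) \<Rightarrow> bool" where
  "quasi_potential X \<phi> \<psi> h p \<longleftrightarrow>
    (\<forall>i. \<forall>x\<in>profiles X. \<forall>w. \<phi> i x w = \<psi> i x + h x w) \<and>
    (\<forall>i. \<forall>x\<in>profiles X. \<forall>u\<in>X i.
        \<psi> i x - \<psi> i (deviate x i u) = p x - p (deviate x i u))"

definition feasible_quasi ::
  "('l::finite \<Rightarrow> 'a set) \<Rightarrow> ('a ^ 'l \<Rightarrow> 'y set) \<Rightarrow> (('a ^ 'l) \<times> 'y) set" where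
  "feasible_quasi X S = {(x, w). (\<forall>i. x $ i \<in> X i) \<and> w \<in> S x}"

definition quasi_potential_function ::
  "('x \<Rightarrow> real) \<Rightarrow> ('x \<Rightarrow> 'y \<Rightarrow> real) \<Rightarrow> 'x \<times> 'y \<Rightarrow> real" where
  "quasi_potential_function p h = (\<lambda>(x, w). p x + h x w)"

definition coercive_on :: "('b::real_normed_vector \<Rightarrow> real) \<Rightarrow> 'b set \<Rightarrow> bool" where
  "coercive_on f A \<longleftrightarrow> filterlim f at_top (inf at_infinity (principal A))"

end

theory Submission
  imports Defs
begin

text \<open>
  A minimizer \<open>(x, w)\<close> of the quasi-potential function becomes an equilibrium once every
  leader is given the same conjecture \<open>w\<close>. A deviation \<open>(u, v)\<close> of one leader \<open>i\<close> leads to a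
  pair \<open>(x', v)\<close> that is again feasible for the minimization problem, because feasibility
  asks for one follower equilibrium only and not for agreement with the other leaders'
  conjectures. Along this deviation the objective of leader \<open>i\<close> and the quasi-potential
  function change by the same amount, since the \<open>h\<close>-term is shared and \<open>p\<close> is a potential for
  the remaining terms (\<open>quasi_potential_change\<close>).

  Existence of a minimizer needs two facts. First, the quasi-potential function is
  continuous even if \<open>p\<close> and \<open>h\<close> are not: moving from a
  reference profile to \<open>x\<close> one coordinate at a time, each step changes it by a difference of
  values of a continuous objective (\<open>continuous_on_quasi_potential_function\<close>). Secondly,
  the feasible set is closed, because the solution map of a variational inequality with
  continuous data has a closed graph (\<open>closed_feasible_quasi\<close>). The compact case is then the
  extreme value theorem, and coercivity reduces to it by restriction to a large
  ball (\<open>coercive_attains_inf\<close>).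
\<close>

section \<open>Minimizers are equilibria\<close>

lemma deviate_in_profiles:
  assumes "x \<in> profiles X" "u \<in> X i"
  shows "deviate x i u \<in> profiles X"
  using assms by (auto simp: profiles_def deviate_def)

lemma feasible_quasi_iff:
  "(x, w) \<in> feasible_quasi X S \<longleftrightarrow> x \<in> profiles X \<and> w \<in> S x"
  by (simp add: feasible_quasi_def profiles_def)

lemma is_arg_min_iff_linorder:
  fixes f :: "'b \<Rightarrow> 'c::linorder"
  shows "is_arg_min f (\<lambda>z. z \<in> A) z \<longleftrightarrow> z \<in> A \<and> (\<forall>z'\<in>A. f z \<le> f z')"
  by (auto simp: is_arg_min_linorder)

lemma quasi_potential_change:
  assumes "quasi_potential X \<phi> \<psi> h p" "x \<in> profiles X" "u \<in> X i"
  shows "\<phi> i (deviate x i u) v - \<phi> i x w =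
    quasi_potential_function p h (deviate x i u, v) - quasi_potential_function p h (x, w)"
proof -
  have "\<psi> i x - \<psi> i (deviate x i u) = p x - p (deviate x i u)"
    and "\<phi> i x w = \<psi> i x + h x w"
    and "\<phi> i (deviate x i u) v = \<psi> i (deviate x i u) + h (deviate x i u) v"
    using assms deviate_in_profiles[OF assms(2,3)] by (auto simp: quasi_potential_def)
  then show ?thesis
    by (simp add: quasi_potential_function_def)
qed

lemma global_nash_of_minimizer:
  assumes qp: "quasi_potential X \<phi> \<psi> h p"
    and min: "is_arg_min (quasi_potential_function p h)
      (\<lambda>z. z \<in> feasible_quasi X S) (x, w)"
  shows "global_nash X S \<phi> x (\<chi> i. w)"
proof -
  have xw: "x \<in> profiles X" "w \<in> S x"
    using min by (auto simp: is_arg_min_iff_linorder feasible_quasi_iff)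
  have "\<phi> i x w \<le> \<phi> i (deviate x i u) v"
    if "u \<in> X i" "v \<in> S (deviate x i u)" for i u v
  proof -
    have "(deviate x i u, v) \<in> feasible_quasi X S"
      using that xw deviate_in_profiles by (auto simp: feasible_quasi_iff)
    then have "quasi_potential_function p h (x, w) \<le>
        quasi_potential_function p h (deviate x i u, v)"
      using min by (auto simp: is_arg_min_iff_linorder)
    then show ?thesis
      using quasi_potential_change[where v = v and w = w, OF qp xw(1) that(1)] by linarith
  qed
  then show ?thesis
    using xw by (auto simp: global_nash_def feasible_def leader_feasible_def profiles_def)
qed

section \<open>Continuity of the quasi-potential function\<close>

definition patch :: "'a ^ 'l \<Rightarrow> 'l::finite set \<Rightarrow> 'a ^ 'l \<Rightarrow> 'a ^ 'l" where
  "patch a J x = (\<chi> j. if j \<in> J then x $ j else a $ j)"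

lemma patch_in_profiles:
  "a \<in> profiles X \<Longrightarrow> x \<in> profiles X \<Longrightarrow> patch a J x \<in> profiles X"
  by (auto simp: profiles_def patch_def)

lemma deviate_patch:
  "j \<notin> J \<Longrightarrow> deviate (patch a (insert j J) x) j (a $ j) = patch a J x"
  by (auto simp: deviate_def patch_def vec_eq_iff)

lemma continuous_on_patch:
  fixes a :: "'a::topological_space ^ 'l::finite"
  shows "continuous_on A (patch a J)"
  unfolding patch_def
proof (rule continuous_on_vec_lambda)
  show "continuous_on A (\<lambda>x. if j \<in> J then x $ j else a $ j)" for j
    by (cases "j \<in> J") (auto intro: continuous_intros)
qed

text \<open>
  Both \<open>p\<close> and \<open>h\<close> may be discontinuous: any function of \<open>x\<close> may be added to
  \<open>h\<close> and subtracted from \<open>p\<close> and from all \<open>\<psi> i\<close>. Their sum is continuous because its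
  increments in the direction of leader \<open>j\<close> are increments of \<open>\<phi> j\<close>. The induction
  releases the coordinates one after the other from a fixed reference profile \<open>a\<close>.
\<close>

lemma continuous_on_quasi_potential_function:
  fixes X :: "'l::finite \<Rightarrow> 'a::topological_space set"
    and \<phi> :: "'l \<Rightarrow> 'a ^ 'l \<Rightarrow> 'y::topological_space \<Rightarrow> real"
  assumes qp: "quasi_potential X \<phi> \<psi> h p"
    and cont: "\<And>i. continuous_on (profiles X \<times> UNIV) (\<lambda>(x, w). \<phi> i x w)"
  shows "continuous_on (profiles X \<times> UNIV) (quasi_potential_function p h)"
proof (cases "profiles X = {}")
  case False
  then obtain a where a: "a \<in> profiles X" by blast
  let ?f = "quasi_potential_function p h"
  have cont_patch: "continuous_on (profiles X \<times> UNIV) (\<lambda>(x, w). \<phi> i (patch a J x) w)" for i J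
  proof -
    have "continuous_on (profiles X \<times> UNIV) (\<lambda>z. (patch a J (fst z), snd z :: 'y))"
      by (intro continuous_intros continuous_on_compose2[OF continuous_on_patch[of UNIV]]) auto
    then have "continuous_on (profiles X \<times> UNIV)
        (\<lambda>z. (\<lambda>(x, w). \<phi> i x w) (patch a J (fst z), snd z))"
      by (rule continuous_on_compose2[OF cont]) (auto intro: patch_in_profiles a)
    then show ?thesis by (simp add: case_prod_unfold)
  qed
  have "continuous_on (profiles X \<times> UNIV) (\<lambda>(x, w). ?f (patch a J x, w))" for J
  proof (induction J rule: finite_induct[OF finite])
    case 1
    \<comment> \<open>At the reference profile the quasi-potential differs from any one objective by a constant.\<close>
    have "?f (a, w) = \<phi> i a w + (p a - \<psi> i a)" for i w
      using qp a by (simp add: quasi_potential_def quasi_potential_function_def)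
    moreover have "patch a {} x = a" for x
      by (simp add: patch_def)
    ultimately have "?f (patch a {} x, w) =
        \<phi> undefined (patch a {} x) w + (p a - \<psi> undefined a)" for x w
      by simp
    then show ?case
      using continuous_on_add[OF cont_patch[of undefined "{}"] continuous_on_const]
      by (simp add: case_prod_unfold)
  next
    case (2 j J)
    have step: "?f (patch a (insert j J) x, w) =
        ?f (patch a J x, w) + \<phi> j (patch a (insert j J) x) w - \<phi> j (patch a J x) w"
      if "x \<in> profiles X" for x w
    proof -
      have "a $ j \<in> X j" using a by (simp add: profiles_def)
      from quasi_potential_change[where v = w and w = w,
          OF qp patch_in_profiles[where J = "insert j J", OF a that] this]
      show ?thesis
        using 2 by (simp add: deviate_patch)
    qed
    have "continuous_on (profiles X \<times> UNIV) (\<lambda>(x, w).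
        ?f (patch a J x, w) + \<phi> j (patch a (insert j J) x) w - \<phi> j (patch a J x) w)"
      using 2 cont_patch[of j "insert j J"] cont_patch[of j J]
      unfolding case_prod_unfold by (intro continuous_intros)
    then show ?case
      by (rule continuous_on_eq) (auto simp: step)
  qed
  from this[of UNIV] show ?thesis
    by (simp add: patch_def)
qed simp

section \<open>Closedness of the feasible set\<close>

lemma closed_profiles:
  fixes X :: "'l::finite \<Rightarrow> 'a::topological_space set"
  assumes "\<And>i. closed (X i)"
  shows "closed (profiles X)"
proof -
  have "profiles X = (\<Inter>i. (\<lambda>x. x $ i) -` X i)"
    by (auto simp: profiles_def)
  then show ?thesis
    using assms by (auto intro!: closed_vimage continuous_intros)
qed

text \<open>
  Outer semicontinuity of \<open>K\<close> keeps the limit point feasible for the limiting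
  variational inequality. Inner semicontinuity supplies, for each test point \<open>z\<close> of the
  limiting problem, test points of the approximating problems that tend to \<open>z\<close>, so that
  the inequality at \<open>z\<close> is a limit of valid inequalities.
\<close>

lemma closed_feasible_quasi:
  fixes X :: "'l::finite \<Rightarrow> 'a::metric_space set"
    and G :: "'a ^ 'l \<Rightarrow> 'y::real_inner \<Rightarrow> 'y"
  assumes X: "closed (profiles X)"
    and K: "set_valued_continuous_on (profiles X) K"
    and G: "continuous_on (profiles X \<times> UNIV) (\<lambda>(x, y). G x y)"
  shows "closed (feasible_quasi X (follower_eq G K))"
  unfolding closed_sequential_limits
proof (intro allI impI, elim conjE)
  fix s l
  assume s: "\<forall>n. s n \<in> feasible_quasi X (follower_eq G K)" and lim: "s \<longlonglongrightarrow> l"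
  obtain x w where l: "l = (x, w)" by (cases l)
  define \<xi> \<omega> where "\<xi> n = fst (s n)" and "\<omega> n = snd (s n)" for n
  have lims: "\<xi> \<longlonglongrightarrow> x" "\<omega> \<longlonglongrightarrow> w"
    using tendsto_fst[OF lim] tendsto_snd[OF lim] by (simp_all add: \<xi>_def[abs_def] \<omega>_def[abs_def] l)
  have "(\<xi> n, \<omega> n) \<in> feasible_quasi X (follower_eq G K)" for n
    using s by (simp add: \<xi>_def \<omega>_def)
  then have \<xi>: "\<xi> n \<in> profiles X" and \<omega>: "\<omega> n \<in> K (\<xi> n)"
    and vi: "z \<in> K (\<xi> n) \<Longrightarrow> 0 \<le> G (\<xi> n) (\<omega> n) \<bullet> (z - \<omega> n)" for n z
    by (auto simp: feasible_quasi_iff follower_eq_def VI_solutions_def)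
  have x: "x \<in> profiles X"
    using X \<xi> lims(1) closed_sequentially by blast
  have w: "w \<in> K x"
    using K x \<xi> \<omega> lims unfolding set_valued_continuous_on_def outer_semicontinuous_on_def by blast
  have G_lim: "(\<lambda>n. G (\<xi> n) (\<omega> n)) \<longlonglongrightarrow> G x w"
    using continuous_on_tendsto_compose[OF G tendsto_Pair[OF lims]] x \<xi> by simp
  have "0 \<le> G x w \<bullet> (z - w)" if z: "z \<in> K x" for z
  proof -
    obtain \<zeta> where \<zeta>: "\<zeta> \<longlonglongrightarrow> z" "\<forall>\<^sub>F n in sequentially. \<zeta> n \<in> K (\<xi> n)"
      using K x z \<xi> lims(1)
      unfolding set_valued_continuous_on_def inner_semicontinuous_on_def by meson
    show ?thesis
    proof (rule tendsto_lowerbound)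
      show "(\<lambda>n. G (\<xi> n) (\<omega> n) \<bullet> (\<zeta> n - \<omega> n)) \<longlonglongrightarrow> G x w \<bullet> (z - w)"
        by (intro tendsto_intros G_lim \<zeta>(1) lims(2))
      show "\<forall>\<^sub>F n in sequentially. 0 \<le> G (\<xi> n) (\<omega> n) \<bullet> (\<zeta> n - \<omega> n)"
        using \<zeta>(2) by (rule eventually_mono) (rule vi)
    qed simp
  qed
  with x w show "l \<in> feasible_quasi X (follower_eq G K)"
    by (simp add: l feasible_quasi_iff follower_eq_def VI_solutions_def)
qed

section \<open>Existence of minimizers\<close>

lemma coercive_attains_inf:
  fixes f :: "'b::euclidean_space \<Rightarrow> real"
  assumes A: "closed A" "A \<noteq> {}"
    and f: "continuous_on A f" "coercive_on f A"
  shows "\<exists>z\<in>A. \<forall>z'\<in>A. f z \<le> f z'"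
proof -
  obtain a where a: "a \<in> A" using A by blast
  obtain b where b: "\<And>z. b \<le> norm z \<Longrightarrow> z \<in> A \<Longrightarrow> f a \<le> f z"
    using f(2) unfolding coercive_on_def filterlim_at_top eventually_inf_principal
      eventually_at_infinity by meson
  \<comment> \<open>The radius is enlarged so that the ball contains \<open>a\<close>, to which points outside are compared.\<close>
  let ?C = "A \<inter> cball 0 (max b (norm a))"
  have "\<exists>z\<in>?C. \<forall>z'\<in>?C. f z \<le> f z'"
  proof (rule continuous_attains_inf)
    show "compact ?C" using A by (simp add: closed_Int_compact)
    show "?C \<noteq> {}" using a by auto
    show "continuous_on ?C f" using f(1) by (rule continuous_on_subset) simp
  qed
  then obtain z where z: "z \<in> ?C" "\<And>z'. z' \<in> ?C \<Longrightarrow> f z \<le> f z'" by blast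
  have "f z \<le> f z'" if "z' \<in> A" for z'
  proof (cases "norm z' \<le> max b (norm a)")
    case True
    with that z(2) show ?thesis by simp
  next
    case False
    have "f z \<le> f a" using z(2)[of a] a by simp
    also have "f a \<le> f z'" using False by (intro b that) simp
    finally show ?thesis .
  qed
  with z(1) show ?thesis by blast
qed

theorem mainTheorem2:
  fixes V X :: "'l::finite \<Rightarrow> 'a::euclidean_space set"
    and G :: "'a ^ 'l \<Rightarrow> 'y::euclidean_space \<Rightarrow> 'y"
    and K :: "'a ^ 'l \<Rightarrow> 'y set"
    and \<phi> :: "'l \<Rightarrow> 'a ^ 'l \<Rightarrow> 'y \<Rightarrow> real"
    and \<psi> :: "'l \<Rightarrow> 'a ^ 'l \<Rightarrow> real"
    and h :: "'a ^ 'l \<Rightarrow> 'y \<Rightarrow> real"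
    and p :: "'a ^ 'l \<Rightarrow> real"
  assumes "mlmf_game V X G K \<phi>"
    and "quasi_potential X \<phi> \<psi> h p"
    and "feasible_quasi X (follower_eq G K) \<noteq> {}"
    and "\<And>i. continuous_on (profiles X \<times> UNIV) (\<lambda>(x, y). \<phi> i x y)"
  shows
    "((\<exists>z. is_arg_min (quasi_potential_function p h)
              (\<lambda>z. z \<in> feasible_quasi X (follower_eq G K)) z) \<longrightarrow>
        (\<exists>x y. global_nash X (follower_eq G K) \<phi> x y)) \<and>
     (coercive_on (quasi_potential_function p h) (feasible_quasi X (follower_eq G K)) \<or>
      compact (feasible_quasi X (follower_eq G K)) \<longrightarrow>
        (\<exists>z. is_arg_min (quasi_potential_function p h)
              (\<lambda>z. z \<in> feasible_quasi X (follower_eq G K)) z))"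
proof (intro conjI impI)
  assume "\<exists>z. is_arg_min (quasi_potential_function p h)
    (\<lambda>z. z \<in> feasible_quasi X (follower_eq G K)) z"
  then obtain x w where "is_arg_min (quasi_potential_function p h)
      (\<lambda>z. z \<in> feasible_quasi X (follower_eq G K)) (x, w)"
    by auto
  from global_nash_of_minimizer[OF assms(2) this]
  show "\<exists>x y. global_nash X (follower_eq G K) \<phi> x y"
    by blast
next
  let ?f = "quasi_potential_function p h" and ?F = "feasible_quasi X (follower_eq G K)"
  assume "coercive_on ?f ?F \<or> compact ?F"
  moreover have "closed (profiles X)"
    using assms(1) by (intro closed_profiles) (auto simp: mlmf_game_def compact_imp_closed)
  then have "closed ?F"
    using assms(1) by (intro closed_feasible_quasi) (auto simp: mlmf_game_def)
  moreover have "?F \<subseteq> profiles X \<times> UNIV"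
    by (auto simp: feasible_quasi_iff)
  then have "continuous_on ?F ?f"
    by (rule continuous_on_subset[OF continuous_on_quasi_potential_function[OF assms(2,4)]])
  ultimately have "\<exists>z\<in>?F. \<forall>z'\<in>?F. ?f z \<le> ?f z'"
    using coercive_attains_inf continuous_attains_inf assms(3) by metis
  then show "\<exists>z. is_arg_min ?f (\<lambda>z. z \<in> ?F) z"
    by (auto simp: is_arg_min_iff_linorder)
qed

end
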